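(* Let $B\ge 1$, $C\ge 1$ and $k$ be integers with $2\le k\le CB$ and $B\mid k$, and let $p_1,\ldots,p_k\ge 0$ with $\sum_i p_i=1$. The expected number of cache misses in $n$ rounds of the sequence-access process (defined in the context) on an initially empty direct-mapped cache with $C$ blocks of $B$ words is at most $$k+n\left(\frac1B+\frac{k(B-1)}{B^2C}+\frac{(B-1)^2}{B^2C}\sum_{i=1}^k\sum_{j=1}^k\frac{p_ip_j}{p_i+p_j}\right).$$
   Context: Cache model: memory words are indexed by non-negative integers and partitioned into blocks of $B$ consecutive words starting at multiples of $B$. A direct-mapped cache has $C$ cache blocks; word $x$ can only reside in cache block $\lfloor x/B\rfloor \bmod C$. An access to $x$ is a hit if that cache block currently holds the memory block of $x$; otherwise it is a miss and the memory block of $x$ is loaded into that cache block, evicting its previous contents. The cache is initially empty. Sequence-access process: there are $k$ pointers $D_1,\ldots,D_k$. Each round: (1) pick $x\in\{1,\ldots,k\}$ with $\Pr[x=i]=p_i$, independently of all previous picks; (2) access the location pointed to by $D_x$, then increment $D_x$ by 1. Let $d_{i,1},d_{i,2},\ldots$ be the locations accessed via $D_i$. Assumptions: (a) each $d_{i,1}\bmod BC$ is uniform over $\{0,\ldots,BC-1\}$, independently over $i$; (b) the pointers traverse sequences of memory locations disjoint from each other; (d) the pointers $D_1,\ldots,D_k$ are in separate memory blocks. Expectations are over the random picks and starting positions. *)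

theory Defs
  imports "HOL-Probability.Probability"
begin

definition mem_block :: "nat \<Rightarrow> nat \<Rightarrow> nat" where
  "mem_block B x = x div B"

definition cache_block :: "nat \<Rightarrow> nat \<Rightarrow> nat \<Rightarrow> nat" where
  "cache_block B C x = (x div B) mod C"

text \<open>A cache state maps each cache block to the memory block it holds, if any.\<close>

type_synonym cache = "nat \<Rightarrow> nat option"

definition is_hit :: "nat \<Rightarrow> nat \<Rightarrow> cache \<Rightarrow> nat \<Rightarrow> bool" where
  "is_hit B C s x \<longleftrightarrow> s (cache_block B C x) = Some (mem_block B x)"

definition load :: "nat \<Rightarrow> nat \<Rightarrow> cache \<Rightarrow> nat \<Rightarrow> cache" where
  "load B C s x = s(cache_block B C x := Some (mem_block B x))"

fun cache_misses :: "nat \<Rightarrow> nat \<Rightarrow> cache \<Rightarrow> nat list \<Rightarrow> nat" where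
  "cache_misses B C s [] = 0"
| "cache_misses B C s (x # xs) =
     (if is_hit B C s x then cache_misses B C s xs
      else Suc (cache_misses B C (load B C s x) xs))"

definition empty_cache :: cache where
  "empty_cache = (\<lambda>_. None)"

text \<open>Rounds are numbered from 0. For starting positions \<open>d\<close> and picks \<open>x\<close>,
  \<open>pointers d x t i\<close> is the location pointer \<open>i\<close> points to just before round \<open>t\<close>.\<close>

fun pointers :: "(nat \<Rightarrow> nat) \<Rightarrow> (nat \<Rightarrow> nat) \<Rightarrow> nat \<Rightarrow> nat \<Rightarrow> nat" where
  "pointers d x 0 = d"
| "pointers d x (Suc t) = (pointers d x t)(x t := pointers d x t (x t) + 1)"

definition accesses :: "(nat \<Rightarrow> nat) \<Rightarrow> (nat \<Rightarrow> nat) \<Rightarrow> nat \<Rightarrow> nat list" where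
  "accesses d x n = map (\<lambda>t. pointers d x t (x t)) [0..<n]"

definition traversed :: "(nat \<Rightarrow> nat) \<Rightarrow> (nat \<Rightarrow> nat) \<Rightarrow> nat \<Rightarrow> nat \<Rightarrow> nat set" where
  "traversed d x n i = {pointers d x t i | t. t < n \<and> x t = i}"

text \<open>Disjointness and separateness only concern the \<open>n\<close> rounds considered: pointers that are
  incremented forever could not traverse disjoint sets of natural numbers.

  The assumption \<open>indep\<close> states the joint independence of all residues of starting positions
  and all picks, so in particular the picks do not depend on these residues.\<close>

locale sequence_access = prob_space M for M :: "'a measure" +
  fixes B C k n :: nat
    and p :: "nat \<Rightarrow> real"
    and start :: "nat \<Rightarrow> 'a \<Rightarrow> nat"
    and pick :: "nat \<Rightarrow> 'a \<Rightarrow> nat"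
  assumes start_measurable:
      "\<And>i. i \<in> {1..k} \<Longrightarrow> random_variable (count_space UNIV) (start i)"
    and pick_measurable:
      "\<And>t. t < n \<Longrightarrow> random_variable (count_space {1..k}) (pick t)"
    and pick_distribution:
      "\<And>t i. t < n \<Longrightarrow> i \<in> {1..k} \<Longrightarrow> \<P>(\<omega> in M. pick t \<omega> = i) = p i"
    and start_uniform:
      "\<And>i r. i \<in> {1..k} \<Longrightarrow> r < B * C \<Longrightarrow>
         \<P>(\<omega> in M. start i \<omega> mod (B * C) = r) = 1 / real (B * C)"
    and indep:
      "indep_vars (\<lambda>_. count_space UNIV)
         (case_sum (\<lambda>i \<omega>. start i \<omega> mod (B * C)) pick) ({1..k} <+> {..<n})"
    and disjoint_sequences:
      "AE \<omega> in M. disjoint_family_on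
         (traversed (\<lambda>i. start i \<omega>) (\<lambda>t. pick t \<omega>) n) {1..k}"
    and separate_blocks:
      "AE \<omega> in M. \<forall>t<n. inj_on
         (\<lambda>i. mem_block B (pointers (\<lambda>i. start i \<omega>) (\<lambda>t. pick t \<omega>) t i)) {1..k}"

end

theory Submission imports Defs begin

text \<open>A miss by pointer \<open>i\<close> in round \<open>t\<close> has one of three causes: it is the first access through
  \<open>i\<close>, or the access starts a new block, or some \<open>j \<noteq> i\<close> picked since the previous access through \<open>i\<close>
  has accessed the cache block that \<open>i\<close> needs now. The first cause contributes at most \<open>k\<close> in
  total and the second at most \<open>n/B\<close>. For the third, fix the picks and let \<open>S\<close> be the
  set of rounds since the previous access through \<open>i\<close> in which \<open>j\<close> was picked. Of the \<open>(BC)\<^sup>2\<close> pairs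
  of residues of the two starting positions, at most \<open>C(B-1)(B-1+|S|)\<close> lead to a collision when \<open>S\<close>
  is nonempty, and none otherwise. The sets \<open>S\<close> belonging to different rounds in which \<open>i\<close> is picked
  are disjoint, so the expectations of \<open>|S|\<close> add up to at most \<open>n p\<^sub>j\<close>. That \<open>i\<close> is
  picked and \<open>S\<close> is nonempty has probability at most \<open>p\<^sub>i p\<^sub>j / (p\<^sub>i + p\<^sub>j)\<close>, by a geometric series over
  the last round in \<open>S\<close>.\<close>

section \<open>Pointer positions in terms of the picks\<close>

text \<open>Round \<open>t\<close> itself is excluded, so the value is the offset of pointer
  \<open>i\<close> from its start at the moment of the access in round \<open>t\<close>.\<close>

definition pick_count :: "(nat \<Rightarrow> nat) \<Rightarrow> nat \<Rightarrow> nat \<Rightarrow> nat" where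
  "pick_count w i t = card {s. s < t \<and> w s = i}"

text \<open>If \<open>i\<close> has not been picked before round \<open>t\<close>, these are all picks of \<open>j\<close> before \<open>t\<close>.\<close>

definition recent_picks :: "(nat \<Rightarrow> nat) \<Rightarrow> nat \<Rightarrow> nat \<Rightarrow> nat \<Rightarrow> nat set" where
  "recent_picks w i j t = {u. u < t \<and> w u = j \<and> (\<forall>v. u < v \<and> v < t \<longrightarrow> w v \<noteq> i)}"

lemma finite_recent_picks [simp]: "finite (recent_picks w i j t)"
  unfolding recent_picks_def by simp

lemma pick_count_Suc:
  "pick_count w i (Suc t) = (if w t = i then Suc (pick_count w i t) else pick_count w i t)"
proof -
  have "{s. s < Suc t \<and> w s = i} = (if w t = i then insert t {s. s < t \<and> w s = i} else {s. s < t \<and> w s = i})"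
    by (auto simp: less_Suc_eq)
  then show ?thesis by (simp add: pick_count_def)
qed

lemma pick_count_mono: "s \<le> t \<Longrightarrow> pick_count w i s \<le> pick_count w i t"
  unfolding pick_count_def by (intro card_mono) auto

lemma pointers_eq: "pointers d w t i = d i + pick_count w i t"
proof (induction t arbitrary: i)
  case 0
  then show ?case by (simp add: pick_count_def)
qed (auto simp: pick_count_Suc)

lemma pointers_cong:
  assumes "\<And>s. s < t \<Longrightarrow> w s = w' s"
  shows "pointers d w t = pointers d w' t"
  using assms by (induction t) auto

text \<open>Lets the random picks be replaced by their restriction to the first \<open>n\<close>
  rounds.\<close>

lemma accesses_cong:
  assumes "\<And>s. s < n \<Longrightarrow> w s = w' s"
  shows "accesses d w n = accesses d w' n"
  unfolding accesses_def
proof (rule map_cong[OF refl])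
  fix t assume "t \<in> set [0..<n]"
  then have "t < n" by simp
  then show "pointers d w t (w t) = pointers d w' t (w' t)"
    using pointers_cong[of t w w' d] assms by simp
qed

section \<open>Cache states and the causes of a miss\<close>

text \<open>\<open>cache_misses\<close> loads only on a miss. Because loading on a hit changes
  nothing, the state after any accesses is still the plain fold of \<open>load\<close>.\<close>

lemma load_of_hit: "is_hit B C s x \<Longrightarrow> load B C s x = s"
  unfolding is_hit_def load_def by (auto simp: fun_upd_idem)

lemma load_apply: "load B C s x c = (if c = cache_block B C x then Some (mem_block B x) else s c)"
  by (simp add: load_def)

lemma cache_misses_snoc:
  "cache_misses B C s (xs @ [x]) =
    cache_misses B C s xs + (if is_hit B C (foldl (load B C) s xs) x then 0 else 1)"
  by (induction xs arbitrary: s) (auto simp: load_of_hit)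

lemma cache_misses_sum:
  "cache_misses B C s (map f [0..<n]) =
    (\<Sum>t<n. if is_hit B C (foldl (load B C) s (map f [0..<t])) (f t) then 0 else 1)"
  by (induction n) (simp_all add: cache_misses_snoc)

text \<open>Each load overwrites exactly one cache block, so the content of \<open>c\<close> is
  decided by the last access mapped to it.\<close>

lemma foldl_load_last:
  assumes "v < t" "cache_block B C (f v) = c"
    and "\<And>u. v < u \<Longrightarrow> u < t \<Longrightarrow> cache_block B C (f u) \<noteq> c"
  shows "foldl (load B C) s (map f [0..<t]) c = Some (mem_block B (f v))"
  using assms
proof (induction t)
  case (Suc t)
  show ?case
  proof (cases "v = t")
    case False
    then have "v < t" using Suc.prems by simp
    then have "foldl (load B C) s (map f [0..<t]) c = Some (mem_block B (f v))"
      using Suc.prems by (intro Suc.IH) auto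
    moreover have "cache_block B C (f t) \<noteq> c" using Suc.prems(3) \<open>v < t\<close> by blast
    ultimately show ?thesis by (simp add: load_apply[of _ _ _ _ c])
  qed (use Suc.prems in \<open>simp add: load_apply[of _ _ _ _ c]\<close>)
qed simp

lemma div_pred_eq:
  assumes "(x + 1) mod B \<noteq> (0::nat)"
  shows "(x + 1) div B = x div B"
  using assms by (simp add: div_Suc)

text \<open>Without such a collision the access would be a hit: the previous access through the same
  pointer was at the preceding word of the same memory block, and nothing has touched its cache
  block since.\<close>

lemma miss_cause:
  assumes miss: "\<not> is_hit B C (foldl (load B C) s (map (\<lambda>t. pointers d w t (w t)) [0..<t]))
      (pointers d w t (w t))"
    and nonzero: "pointers d w t (w t) mod B \<noteq> 0"
    and again: "\<exists>s<t. w s = w t"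
  shows "\<exists>j u. j \<noteq> w t \<and> u \<in> recent_picks w (w t) j t \<and>
    cache_block B C (d j + pick_count w j u) = cache_block B C (d (w t) + pick_count w (w t) t)"
proof (rule ccontr)
  assume no: "\<not> ?thesis"
  define i where "i = w t"
  let ?f = "\<lambda>t. pointers d w t (w t)"
  define v where "v = Max {s. s < t \<and> w s = i}"
  have "v \<in> {s. s < t \<and> w s = i}"
    unfolding v_def using again by (intro Max_in) (auto simp: i_def)
  then have v: "v < t" "w v = i" by auto
  have later: "w u \<noteq> i" if "v < u" "u < t" for u
    using Max_ge[of "{s. s < t \<and> w s = i}" u] that unfolding v_def[symmetric] by auto
  \<comment> \<open>No pick of \<open>i\<close> lies strictly between \<open>v\<close>, the previous
    one, and \<open>t\<close>, so the pointer has advanced by exactly one word.\<close>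
  have "{s. s < t \<and> w s = i} = {s. s < Suc v \<and> w s = i}"
    using v later by (auto simp: less_Suc_eq) (meson not_less_iff_gr_or_eq)
  then have "pick_count w i t = Suc (pick_count w i v)"
    using v pick_count_Suc[of w i v] by (simp add: pick_count_def)
  then have step: "?f t = ?f v + 1" by (simp add: pointers_eq v i_def[symmetric])
  have same: "?f t div B = ?f v div B"
    using div_pred_eq[of "?f v" B] nonzero step by simp
  have "foldl (load B C) s (map ?f [0..<t]) (cache_block B C (?f t)) = Some (mem_block B (?f v))"
  proof (rule foldl_load_last)
    show "cache_block B C (?f v) = cache_block B C (?f t)" by (simp add: cache_block_def same)
    \<comment> \<open>Every access after \<open>v\<close> comes from a pointer other than
      \<open>i\<close> and is recent, so \<open>no\<close> keeps it out of this cache block.\<close>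
    fix u assume u: "v < u" "u < t"
    then have "w u \<noteq> i" "u \<in> recent_picks w i (w u) t"
      using later by (auto simp: recent_picks_def)
    then show "cache_block B C (?f u) \<noteq> cache_block B C (?f t)"
      using no by (auto simp: pointers_eq i_def)
  qed (use v in auto)
  then show False using miss same by (simp add: is_hit_def mem_block_def)
qed

text \<open>\<open>a\<close> and \<open>b\<close> are the starting positions of \<open>i\<close> and \<open>j\<close>, or just their residues modulo \<open>B * C\<close>.\<close>

definition collision :: "nat \<Rightarrow> nat \<Rightarrow> (nat \<Rightarrow> nat) \<Rightarrow> nat \<Rightarrow> nat \<Rightarrow> nat \<Rightarrow> nat \<Rightarrow> nat \<Rightarrow> bool" where
  "collision B C w t i j a b \<longleftrightarrow> w t = i \<and> (a + pick_count w i t) mod B \<noteq> 0 \<and>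
    (\<exists>u \<in> recent_picks w i j t.
      cache_block B C (b + pick_count w j u) = cache_block B C (a + pick_count w i t))"

lemma mod_add_residue: "(a mod (B * C) + q) mod B = (a + q) mod (B::nat)"
  by (metis mod_add_left_eq mod_mod_cancel dvd_triv_left)

lemma cache_block_eq: "cache_block B C x = x mod (B * C) div B"
  by (cases "B = 0") (simp_all add: cache_block_def mod_mult2_eq)

lemma cache_block_residue: "cache_block B C (a mod (B * C) + q) = cache_block B C (a + q)"
  unfolding cache_block_eq by (simp add: mod_simps)

text \<open>Both conditions see the starts only modulo \<open>B * C\<close>: it is a multiple of
  \<open>B\<close>, and the cache block of an address depends on its residue alone. Hence uniform
  residues suffice for the averaging.\<close>

lemma collision_residue:
  "collision B C w t i j (a mod (B * C)) (b mod (B * C)) = collision B C w t i j a b"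
  unfolding collision_def by (simp add: mod_add_residue cache_block_residue)

section \<open>Bounding the misses for fixed picks and starting positions\<close>

text \<open>\<open>w\<close> is injective on the rounds that pick a pointer for the first
  time.\<close>

lemma card_first_picks:
  fixes w :: "nat \<Rightarrow> nat"
  assumes "\<And>t. t < n \<Longrightarrow> w t \<in> {1..k}"
  shows "(\<Sum>t<n. of_bool (\<forall>s<t. w s \<noteq> w t) :: real) \<le> real k"
proof -
  have "inj_on w {t. t < n \<and> (\<forall>s<t. w s \<noteq> w t)}"
    by (rule inj_onI) (metis (mono_tags, lifting) mem_Collect_eq nat_neq_iff)
  then have "card {t. t < n \<and> (\<forall>s<t. w s \<noteq> w t)} \<le> card {1..k}"
    using assms by (intro card_inj_on_le[of w]) auto
  moreover have "{..<n} \<inter> {t. \<forall>s<t. w s \<noteq> w t} = {t. t < n \<and> (\<forall>s<t. w s \<noteq> w t)}" by auto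
  ultimately show ?thesis by (simp add: sum.If_cases of_bool_def)
qed

text \<open>Round by round, the miss indicator is dominated by the sum of the indicators of the
  three causes. A miss with several causes or several colliding pointers is merely counted more than
  once.\<close>

lemma cache_misses_bound:
  assumes w: "\<And>t. t < n \<Longrightarrow> w t \<in> {1..k}"
  shows "real (cache_misses B C empty_cache (accesses d w n)) \<le> real k +
    (\<Sum>t<n. \<Sum>i=1..k. of_bool (w t = i \<and> (d i mod (B * C) + pick_count w i t) mod B = 0)) +
    (\<Sum>t<n. \<Sum>i=1..k. \<Sum>j\<in>{1..k} - {i}.
      of_bool (collision B C w t i j (d i mod (B * C)) (d j mod (B * C))))"
proof -
  let ?f = "\<lambda>t. pointers d w t (w t)"
  let ?miss = "\<lambda>t. if is_hit B C (foldl (load B C) empty_cache (map ?f [0..<t])) (?f t) then 0 else (1::real)"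
  let ?first = "\<lambda>t. of_bool (\<forall>s<t. w s \<noteq> w t) :: real"
  let ?new = "\<lambda>t i. of_bool (w t = i \<and> (d i mod (B * C) + pick_count w i t) mod B = 0) :: real"
  let ?col = "\<lambda>t i j. of_bool (collision B C w t i j (d i mod (B * C)) (d j mod (B * C))) :: real"
  have pt: "?miss t \<le> ?first t + (\<Sum>i=1..k. ?new t i) + (\<Sum>i=1..k. \<Sum>j\<in>{1..k} - {i}. ?col t i j)"
    if t: "t < n" for t
  proof -
    have new: "?new t (w t) \<le> (\<Sum>i=1..k. ?new t i)"
      using w[OF t] by (intro member_le_sum) auto
    have pos: "0 \<le> (\<Sum>i=1..k. ?new t i)" "0 \<le> (\<Sum>i=1..k. \<Sum>j\<in>{1..k} - {i}. ?col t i j)"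
      by (auto intro!: sum_nonneg)
    have col: "1 \<le> (\<Sum>i=1..k. \<Sum>j\<in>{1..k} - {i}. ?col t i j)"
      if "?miss t \<noteq> 0" "?first t = 0" "?new t (w t) = 0"
    proof -
      have "\<exists>j u. j \<noteq> w t \<and> u \<in> recent_picks w (w t) j t \<and>
          cache_block B C (d j + pick_count w j u) = cache_block B C (d (w t) + pick_count w (w t) t)"
        using that by (intro miss_cause[where s = empty_cache])
          (auto simp: pointers_eq mod_add_residue split: if_splits)
      then obtain j u where ju: "j \<noteq> w t" "u \<in> recent_picks w (w t) j t"
          "cache_block B C (d j + pick_count w j u) = cache_block B C (d (w t) + pick_count w (w t) t)"
        by blast
      \<comment> \<open>The pick in round \<open>u\<close> itself shows that \<open>j\<close> is the
        index of a pointer.\<close>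
      have "w u = j" "u < n" using ju(2) t by (auto simp: recent_picks_def)
      then have j: "j \<in> {1..k}" using w by blast
      have "collision B C w t (w t) j (d (w t)) (d j)"
        unfolding collision_def using ju that(3) by (auto simp: mod_add_residue)
      then have "1 = ?col t (w t) j" by (simp add: collision_residue)
      also have "\<dots> \<le> (\<Sum>j\<in>{1..k} - {w t}. ?col t (w t) j)"
        using j ju(1) by (intro member_le_sum) auto
      also have "\<dots> \<le> (\<Sum>i=1..k. \<Sum>j\<in>{1..k} - {i}. ?col t i j)"
        using w[OF t] by (intro member_le_sum) (auto intro!: sum_nonneg)
      finally show ?thesis .
    qed
    \<comment> \<open>The case distinction is made on plain reals, away from the nested
      sums.\<close>
    have combine: "m \<le> f + s + c"
      if "m = 0 \<or> m = 1" "f = 0 \<or> f = 1" "x = 0 \<or> x = 1" "x \<le> s" "0 \<le> s" "0 \<le> c"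
        "m \<noteq> 0 \<Longrightarrow> f = 0 \<Longrightarrow> x = 0 \<Longrightarrow> 1 \<le> c" for m f x s c :: real
      using that by auto
    have bool: "of_bool P = 0 \<or> of_bool P = (1::real)" for P by simp
    have "?miss t = 0 \<or> ?miss t = 1" by simp
    from this bool bool new pos col show ?thesis by (rule combine)
  qed
  have "real (cache_misses B C empty_cache (accesses d w n)) = (\<Sum>t<n. ?miss t)"
    unfolding accesses_def cache_misses_sum of_nat_sum by (intro sum.cong) auto
  also have "\<dots> \<le> (\<Sum>t<n. ?first t + (\<Sum>i=1..k. ?new t i) + (\<Sum>i=1..k. \<Sum>j\<in>{1..k} - {i}. ?col t i j))"
    using pt by (intro sum_mono) auto
  also have "\<dots> = (\<Sum>t<n. ?first t) + (\<Sum>t<n. \<Sum>i=1..k. ?new t i) +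
      (\<Sum>t<n. \<Sum>i=1..k. \<Sum>j\<in>{1..k} - {i}. ?col t i j)"
    by (simp only: sum.distrib)
  also have "\<dots> \<le> real k + (\<Sum>t<n. \<Sum>i=1..k. ?new t i) +
      (\<Sum>t<n. \<Sum>i=1..k. \<Sum>j\<in>{1..k} - {i}. ?col t i j)"
    using w by (intro add_right_mono card_first_picks)
  finally show ?thesis .
qed

section \<open>Counting the residues that cause misses\<close>

text \<open>The shift by \<open>q\<close> only changes which residue class modulo \<open>B\<close>
  is counted, and each class has one member in each of the \<open>C\<close> blocks.\<close>

lemma card_shifted_multiples:
  assumes "B \<ge> 1"
  shows "card {a. a < B * C \<and> (a + q) mod B = (0::nat)} = C"
proof -
  \<comment> \<open>\<open>r\<close> represents \<open>-q\<close> modulo \<open>B\<close>; the outer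
    \<open>mod\<close> turns the value \<open>B\<close> into \<open>0\<close> when \<open>B\<close>
    divides \<open>q\<close>.\<close>
  define r where "r = (B - q mod B) mod B"
  have r: "r < B" using assms by (simp add: r_def)
  have rq: "(r + q) mod B = 0"
    using assms unfolding r_def
    by (metis add.commute le_add_diff_inverse mod_add_left_eq mod_add_right_eq mod_less_divisor
        mod_self less_imp_le_nat One_nat_def Suc_le_lessD)
  have "(a + q) mod B = 0 \<longleftrightarrow> a mod B = r" for a
  proof
    assume "(a + q) mod B = 0"
    then have "B dvd a + q" "B dvd r + q" using rq by auto
    \<comment> \<open>Passing to integers avoids truncated subtraction when
      \<open>a < r\<close>.\<close>
    then have "int B dvd int (a + q) - int (r + q)" by (intro dvd_diff) (simp_all only: of_nat_dvd_iff)
    then have "int a mod int B = int r mod int B" by (simp add: mod_eq_dvd_iff)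
    then have "a mod B = r mod B" by (metis of_nat_mod of_nat_eq_iff)
    then show "a mod B = r" using r by simp
  next
    assume "a mod B = r"
    then show "(a + q) mod B = 0" using rq by (metis mod_add_left_eq)
  qed
  then have "{a. a < B * C \<and> (a + q) mod B = 0} = {a. a < B * C \<and> a mod B = r}" by auto
  also have "\<dots> = (\<lambda>m. m * B + r) ` {..<C}"
  proof (intro equalityI subsetI)
    fix a assume "a \<in> {a. a < B * C \<and> a mod B = r}"
    then have a: "a < B * C" "a mod B = r" by auto
    then have "a div B < C" by (simp add: less_mult_imp_div_less mult.commute)
    moreover have "a = a div B * B + r" using a by (metis div_mult_mod_eq)
    ultimately show "a \<in> (\<lambda>m. m * B + r) ` {..<C}" by blast
  next
    fix a assume "a \<in> (\<lambda>m. m * B + r) ` {..<C}"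
    then obtain m where m: "m < C" "a = m * B + r" by auto
    have "m * B + r < Suc m * B" using r by simp
    also have "\<dots> \<le> C * B" using m by (intro mult_right_mono) auto
    finally show "a \<in> {a. a < B * C \<and> a mod B = r}" using m r by (simp add: mult.commute)
  qed
  also have "card \<dots> = C" using assms by (subst card_image) (auto intro!: inj_onI)
  finally show ?thesis .
qed

lemma card_shifted_nonmultiples:
  assumes "B \<ge> 1"
  shows "card {a. a < B * C \<and> (a + q) mod B \<noteq> (0::nat)} = C * (B - 1)"
proof -
  have "{a. a < B * C \<and> (a + q) mod B \<noteq> 0} = {..<B * C} - {a. a < B * C \<and> (a + q) mod B = 0}" by auto
  moreover have "card ({..<B * C} - {a. a < B * C \<and> (a + q) mod B = 0}) = B * C - C"
    using card_shifted_multiples[OF assms, of C q] by (subst card_Diff_subset) auto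
  ultimately have "card {a. a < B * C \<and> (a + q) mod B \<noteq> 0} = B * C - C" by simp
  then show ?thesis by (simp add: diff_mult_distrib2 mult.commute)
qed

lemma card_window:
  assumes B: "B \<ge> 1" and C: "C \<ge> 1" and m: "m \<ge> 1"
  shows "card {b. b < B * C \<and> (\<exists>q \<in> {e..<e+m}. cache_block B C (b + q) = c)} \<le> B - 1 + m"
proof -
  \<comment> \<open>A suitable \<open>b\<close> is congruent modulo \<open>B * C\<close> to \<open>y - q\<close> with \<open>y\<close> in block \<open>c\<close>, and these
    differences fill an interval of \<open>B - 1 + m\<close> integers.\<close>
  let ?N = "int (B * C)"
  let ?I = "{int c * int B - int e - int m + 1 .. int c * int B + int B - 1 - int e}"
  have "{b. b < B * C \<and> (\<exists>q \<in> {e..<e+m}. cache_block B C (b + q) = c)} \<subseteq> (\<lambda>z. nat (z mod ?N)) ` ?I"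
  proof
    fix b assume "b \<in> {b. b < B * C \<and> (\<exists>q \<in> {e..<e+m}. cache_block B C (b + q) = c)}"
    then obtain q where b: "b < B * C" and q: "e \<le> q" "q < e + m"
      and c: "(b + q) mod (B * C) div B = c" by (auto simp: cache_block_eq)
    define y where "y = (b + q) mod (B * C)"
    have y: "c * B \<le> y" "y < c * B + B"
      using c B dividend_less_div_times[of B y] by (auto simp: y_def)
    have "int y = (int b + int q) mod ?N" by (simp add: y_def zmod_int)
    then have "(int y - int q) mod ?N = int b mod ?N" by (simp add: mod_simps)
    moreover have "int b mod ?N = int b" using b by (intro mod_pos_pos_trivial) (simp_all only: of_nat_less_iff of_nat_0_le_iff)
    ultimately have "b = nat ((int y - int q) mod ?N)" by simp
    moreover have "int y - int q \<in> ?I"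
    proof -
      have "int c * int B \<le> int y" "int y < int c * int B + int B"
        using y by (metis of_nat_le_iff of_nat_mult, metis of_nat_less_iff of_nat_mult of_nat_add)
      then show ?thesis using q by auto
    qed
    ultimately show "b \<in> (\<lambda>z. nat (z mod ?N)) ` ?I" by blast
  qed
  then have "card {b. b < B * C \<and> (\<exists>q \<in> {e..<e+m}. cache_block B C (b + q) = c)} \<le> card ?I"
    by (rule surj_card_le[rotated]) simp
  also have "\<dots> = B - 1 + m" using B m by (simp add: nat_eq_iff)
  finally show ?thesis .
qed

text \<open>Every pick of \<open>j\<close> from the first recent one on and before \<open>t\<close>
  is itself recent, as \<open>i\<close> is absent from that point. So the offsets of pointer
  \<open>j\<close> that matter form a window whose length is the number of recent picks.\<close>

lemma pick_count_recent_picks: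
  assumes "u \<in> recent_picks w i j t"
  defines "e \<equiv> pick_count w j (Min (recent_picks w i j t))"
  shows "pick_count w j u \<in> {e..<e + card (recent_picks w i j t)}"
proof -
  let ?S = "recent_picks w i j t"
  define v where "v = Min ?S"
  have v: "v \<in> ?S" unfolding v_def using assms by (intro Min_in) auto
  have vu: "v \<le> u" unfolding v_def using assms by (intro Min_le) auto
  \<comment> \<open>Removing \<open>u\<close> from the recent picks is what makes the final
    inequality strict.\<close>
  have "{s. s < u \<and> w s = j} \<subseteq> {s. s < v \<and> w s = j} \<union> (?S - {u})"
  proof
    fix s assume s: "s \<in> {s. s < u \<and> w s = j}"
    show "s \<in> {s. s < v \<and> w s = j} \<union> (?S - {u})"
    proof (cases "s < v")
      case False
      then have "w x \<noteq> i" if "s < x" "x < t" for x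
        using v that by (auto simp: recent_picks_def)
      then show ?thesis using s assms(1) by (auto simp: recent_picks_def)
    qed (use s in auto)
  qed
  then have "card {s. s < u \<and> w s = j} \<le> card ({s. s < v \<and> w s = j} \<union> (?S - {u}))"
    by (intro card_mono) auto
  also have "\<dots> \<le> card {s. s < v \<and> w s = j} + card (?S - {u})" by (rule card_Un_le)
  also have "\<dots> < card {s. s < v \<and> w s = j} + card ?S"
    using assms(1) by (intro add_strict_left_mono psubset_card_mono) auto
  finally show ?thesis
    using pick_count_mono[OF vu, of w j] by (simp add: e_def v_def pick_count_def)
qed

text \<open>There are \<open>C * (B - 1)\<close> admissible \<open>a\<close>, those not leading to
  the start of a block, and for each of them \<open>card_window\<close> limits \<open>b\<close>.
  Without recent picks no collision is possible, whereas the window bound would still give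
  \<open>B - 1\<close>; hence the indicator.\<close>

lemma card_collision:
  assumes B: "B \<ge> 1" and C: "C \<ge> 1"
  shows "(\<Sum>a<B*C. \<Sum>b<B*C. of_bool (collision B C w t i j a b)) \<le>
    of_bool (w t = i) * (real C * (real B - 1) *
      ((real B - 1) * of_bool (recent_picks w i j t \<noteq> {}) + real (card (recent_picks w i j t))))"
proof (cases "w t = i \<and> recent_picks w i j t \<noteq> {}")
  case False
  then have "\<not> collision B C w t i j a b" for a b by (auto simp: collision_def)
  then show ?thesis using B by (simp add: mult_nonneg_nonneg)
next
  case True
  let ?S = "recent_picks w i j t"
  let ?P = "\<lambda>a. (a + pick_count w i t) mod B \<noteq> 0"
  have m: "card ?S \<ge> 1" using True by (metis One_nat_def Suc_leI card_gt_0_iff finite_recent_picks)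
  have inner: "(\<Sum>b<B*C. of_bool (collision B C w t i j a b)) \<le> of_bool (?P a) * (real B - 1 + real (card ?S))"
    for a
  proof (cases "?P a")
    case False
    then show ?thesis by (simp add: collision_def)
  next
    case Pa: True
    define e where "e = pick_count w j (Min ?S)"
    define c where "c = cache_block B C (a + pick_count w i t)"
    have "{b. b < B * C \<and> collision B C w t i j a b} \<subseteq>
        {b. b < B * C \<and> (\<exists>q \<in> {e..<e + card ?S}. cache_block B C (b + q) = c)}"
      using pick_count_recent_picks[of _ w i j t] unfolding collision_def e_def c_def by blast
    then have "card {b. b < B * C \<and> collision B C w t i j a b} \<le>
        card {b. b < B * C \<and> (\<exists>q \<in> {e..<e + card ?S}. cache_block B C (b + q) = c)}"
      by (intro card_mono) auto
    also have "\<dots> \<le> B - 1 + card ?S" by (rule card_window[OF B C m])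
    finally have "real (card {b. b < B * C \<and> collision B C w t i j a b}) \<le> real B - 1 + real (card ?S)"
      using B by linarith
    moreover have "{..<B*C} \<inter> {b. collision B C w t i j a b} = {b. b < B * C \<and> collision B C w t i j a b}"
      by auto
    ultimately show ?thesis using Pa by (simp add: of_bool_def sum.If_cases)
  qed
  have "(\<Sum>a<B*C. \<Sum>b<B*C. of_bool (collision B C w t i j a b)) \<le>
      (\<Sum>a<B*C. of_bool (?P a) * (real B - 1 + real (card ?S)))"
    by (intro sum_mono inner)
  also have "\<dots> = (\<Sum>a<B*C. of_bool (?P a)) * (real B - 1 + real (card ?S))"
    by (simp add: sum_distrib_right)
  also have "(\<Sum>a<B*C. of_bool (?P a)) = real (C * (B - 1))"
  proof -
    have "{..<B*C} \<inter> {a. ?P a} = {a. a < B * C \<and> ?P a}" by auto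
    then show ?thesis
      using card_shifted_nonmultiples[OF B, of C "pick_count w i t"] by (simp add: of_bool_def sum.If_cases)
  qed
  finally show ?thesis using True B by (simp add: of_nat_diff)
qed

text \<open>After exchanging the sums, a pick of \<open>j\<close> in round \<open>u\<close> is
  counted at most once, namely at the next pick of \<open>i\<close> after \<open>u\<close>.\<close>

lemma sum_card_recent_picks:
  "(\<Sum>t<n. of_bool (w t = i) * real (card (recent_picks w i j t))) \<le> (\<Sum>u<n. of_bool (w u = j))"
proof -
  have "(\<Sum>t<n. of_bool (w t = i) * real (card (recent_picks w i j t))) =
      (\<Sum>t<n. \<Sum>u<n. of_bool (w t = i \<and> u \<in> recent_picks w i j t))"
  proof (intro sum.cong refl)
    fix t assume "t \<in> {..<n}"
    then have "{..<n} \<inter> {u. u \<in> recent_picks w i j t} = recent_picks w i j t"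
      by (auto simp: recent_picks_def)
    then show "of_bool (w t = i) * real (card (recent_picks w i j t)) =
        (\<Sum>u<n. of_bool (w t = i \<and> u \<in> recent_picks w i j t))"
      by (simp add: of_bool_def sum.If_cases)
  qed
  also have "\<dots> = (\<Sum>u<n. \<Sum>t<n. of_bool (w t = i \<and> u \<in> recent_picks w i j t))"
    by (rule sum.swap)
  also have "\<dots> \<le> (\<Sum>u<n. of_bool (w u = j))"
  proof (intro sum_mono)
    fix u
    let ?T = "{..<n} \<inter> {t. w t = i \<and> u \<in> recent_picks w i j t}"
    \<comment> \<open>Of two such rounds, the earlier would be a pick of \<open>i\<close> strictly
      between \<open>u\<close> and the later one.\<close>
    have "t = t'" if "t \<in> ?T" "t' \<in> ?T" for t t'
      using that by (auto simp: recent_picks_def) (metis nat_neq_iff)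
    then have "card ?T \<le> 1" by (simp add: card_le_Suc0_iff_eq)
    moreover have "?T = {}" if "w u \<noteq> j" using that by (auto simp: recent_picks_def)
    ultimately show "(\<Sum>t<n. of_bool (w t = i \<and> u \<in> recent_picks w i j t)) \<le> (of_bool (w u = j) :: real)"
      by (cases "w u = j") (simp_all add: of_bool_def sum.If_cases)
  qed
  finally show ?thesis .
qed

section \<open>Expectations of finitely valued random variables\<close>

text \<open>On the sample space \<open>f (Z \<omega>)\<close> is a finite combination of indicators
  of the level sets of \<open>Z\<close>, which settles integrability and value together.\<close>

lemma (in prob_space)
  fixes f :: "'b \<Rightarrow> real"
  assumes Z: "Z \<in> measurable M (count_space F)" and F: "finite F"
  shows integrable_finite_range: "integrable M (\<lambda>\<omega>. f (Z \<omega>))"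
    and expectation_finite_range:
      "expectation (\<lambda>\<omega>. f (Z \<omega>)) = (\<Sum>z\<in>F. f z * prob {\<omega> \<in> space M. Z \<omega> = z})"
proof -
  let ?E = "\<lambda>z. {\<omega> \<in> space M. Z \<omega> = z}"
  have E: "?E z \<in> events" if "z \<in> F" for z
  proof -
    have "?E z = Z -` {z} \<inter> space M" by auto
    then show ?thesis using measurable_sets[OF Z, of "{z}"] that by simp
  qed
  have eq: "f (Z \<omega>) = (\<Sum>z\<in>F. f z * indicator (?E z) \<omega>)" if "\<omega> \<in> space M" for \<omega>
  proof -
    have "Z \<omega> \<in> F" using measurable_space[OF Z that] by simp
    moreover have "(\<Sum>z\<in>F. f z * indicator (?E z) \<omega>) = (\<Sum>z\<in>F. if z = Z \<omega> then f z else 0)"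
      using that by (intro sum.cong) (auto simp: indicator_def)
    ultimately show ?thesis using F by simp
  qed
  have int: "integrable M (\<lambda>\<omega>. f z * indicator (?E z) \<omega>)" if "z \<in> F" for z
    using E[OF that] by (intro integrable_mult_right integrable_real_indicator) (auto simp: emeasure_eq_measure)
  show "integrable M (\<lambda>\<omega>. f (Z \<omega>))"
    by (subst Bochner_Integration.integrable_cong[OF refl eq]) (auto intro: int)
  have "expectation (\<lambda>\<omega>. f (Z \<omega>)) = expectation (\<lambda>\<omega>. \<Sum>z\<in>F. f z * indicator (?E z) \<omega>)"
    by (rule Bochner_Integration.integral_cong[OF refl eq])
  also have "\<dots> = (\<Sum>z\<in>F. expectation (\<lambda>\<omega>. f z * indicator (?E z) \<omega>))"
    by (rule Bochner_Integration.integral_sum) (rule int)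
  also have "\<dots> = (\<Sum>z\<in>F. f z * prob (?E z))"
    using E by (intro sum.cong) auto
  finally show "expectation (\<lambda>\<omega>. f (Z \<omega>)) = (\<Sum>z\<in>F. f z * prob (?E z))" .
qed

section \<open>Joint law of residues and picks\<close>

context sequence_access
begin

definition residue :: "nat \<Rightarrow> 'a \<Rightarrow> nat" where
  "residue i \<omega> = start i \<omega> mod (B * C)"

text \<open>Restricting the picks to the rounds considered leaves finitely many possible values.\<close>

definition picks :: "'a \<Rightarrow> nat \<Rightarrow> nat" where
  "picks \<omega> = (\<lambda>t\<in>{..<n}. pick t \<omega>)"

lemma pick_range: "t < n \<Longrightarrow> \<omega> \<in> space M \<Longrightarrow> pick t \<omega> \<in> {1..k}"
  using measurable_space[OF pick_measurable] by simp

lemma pick_event: "t < n \<Longrightarrow> {\<omega> \<in> space M. pick t \<omega> \<in> A} \<in> events"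
proof -
  assume t: "t < n"
  have "{\<omega> \<in> space M. pick t \<omega> \<in> A} = pick t -` (A \<inter> {1..k}) \<inter> space M"
    using pick_range[OF t] by auto
  then show ?thesis using measurable_sets[OF pick_measurable[OF t], of "A \<inter> {1..k}"] by simp
qed

lemma residue_event: "i \<in> {1..k} \<Longrightarrow> {\<omega> \<in> space M. residue i \<omega> \<in> A} \<in> events"
proof -
  assume i: "i \<in> {1..k}"
  have "{\<omega> \<in> space M. residue i \<omega> \<in> A} = start i -` {x. x mod (B * C) \<in> A} \<inter> space M"
    by (auto simp: residue_def)
  moreover have "start i -` {x. x mod (B * C) \<in> A} \<inter> space M \<in> events"
    by (rule measurable_sets[OF start_measurable[OF i]]) simp
  ultimately show ?thesis by (simp only:)
qed

text \<open>Brings the assumption \<open>indep\<close>, indexed by a disjoint sum, into product form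
  with separate factors for pointers and rounds.\<close>

lemma prob_residues_picks:
  assumes V: "V \<subseteq> {1..k}" and U: "U \<subseteq> {..<n}"
  shows "prob {\<omega> \<in> space M. (\<forall>i\<in>V. residue i \<omega> \<in> R i) \<and> (\<forall>t\<in>U. pick t \<omega> \<in> A t)} =
    (\<Prod>i\<in>V. prob {\<omega> \<in> space M. residue i \<omega> \<in> R i}) * (\<Prod>t\<in>U. prob {\<omega> \<in> space M. pick t \<omega> \<in> A t})"
proof (cases "V = {} \<and> U = {}")
  \<comment> \<open>With no constraint both sides are 1. This case is split off because
    \<open>indep_varsD\<close> asks for a nonempty index set.\<close>
  case True
  then show ?thesis by (simp add: prob_space)
next
  case False
  have fin: "finite V" "finite U" using V U by (auto intro: finite_subset)
  let ?X = "case_sum (\<lambda>i \<omega>. start i \<omega> mod (B * C)) pick"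
  let ?S = "\<lambda>l. ?X l -` case_sum R A l \<inter> space M"
  have "prob (\<Inter>l\<in>Inl ` V \<union> Inr ` U. ?S l) = (\<Prod>l\<in>Inl ` V \<union> Inr ` U. prob (?S l))"
    using False fin V U by (intro indep_varsD[OF indep]) auto
  also have "\<dots> = (\<Prod>l\<in>Inl ` V. prob (?S l)) * (\<Prod>l\<in>Inr ` U. prob (?S l))"
    using fin by (intro prod.union_disjoint) auto
  also have "(\<Prod>l\<in>Inl ` V. prob (?S l)) = (\<Prod>i\<in>V. prob {\<omega> \<in> space M. residue i \<omega> \<in> R i})"
    by (subst prod.reindex) (auto intro!: prod.cong arg_cong[where f = prob] simp: residue_def)
  also have "(\<Prod>l\<in>Inr ` U. prob (?S l)) = (\<Prod>t\<in>U. prob {\<omega> \<in> space M. pick t \<omega> \<in> A t})"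
    by (subst prod.reindex) (auto intro!: prod.cong arg_cong[where f = prob])
  also have "(\<Inter>l\<in>Inl ` V \<union> Inr ` U. ?S l) =
      {\<omega> \<in> space M. (\<forall>i\<in>V. residue i \<omega> \<in> R i) \<and> (\<forall>t\<in>U. pick t \<omega> \<in> A t)}"
    using False by (auto simp: residue_def ball_Un)
  finally show ?thesis .
qed

lemma prob_picks:
  "U \<subseteq> {..<n} \<Longrightarrow> prob {\<omega> \<in> space M. \<forall>t\<in>U. pick t \<omega> \<in> A t} = (\<Prod>t\<in>U. prob {\<omega> \<in> space M. pick t \<omega> \<in> A t})"
  using prob_residues_picks[of "{}" U] by simp

abbreviation "pick_vectors \<equiv> {..<n} \<rightarrow>\<^sub>E {1..k}"

lemma finite_pick_vectors: "finite pick_vectors"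
  by (intro finite_PiE) auto

lemma picks_range: "\<omega> \<in> space M \<Longrightarrow> picks \<omega> \<in> pick_vectors"
  using pick_range by (auto simp: picks_def)

text \<open>The singletons on the right match the product form of
  \<open>prob_residues_picks\<close>.\<close>

lemma picks_eq_iff: "w \<in> pick_vectors \<Longrightarrow> picks \<omega> = w \<longleftrightarrow> (\<forall>t\<in>{..<n}. pick t \<omega> \<in> {w t})"
  by (auto simp: picks_def PiE_def extensional_def restrict_def fun_eq_iff)

lemma picks_event: "w \<in> pick_vectors \<Longrightarrow> {\<omega> \<in> space M. picks \<omega> = w} \<in> events"
proof -
  assume w: "w \<in> pick_vectors"
  have "{\<omega> \<in> space M. \<forall>t\<in>{..<n}. pick t \<omega> \<in> {w t}} \<in> events"
    by (intro sets.sets_Collect_finite_All pick_event) auto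
  then show ?thesis using picks_eq_iff[OF w] by simp
qed

lemma picks_measurable: "picks \<in> measurable M (count_space pick_vectors)"
proof -
  have "picks -` {w} \<inter> space M = {\<omega> \<in> space M. picks \<omega> = w}" for w by auto
  then show ?thesis
    using picks_event picks_range unfolding measurable_count_space_eq2[OF finite_pick_vectors] by simp
qed

lemma integrable_picks: "integrable M (\<lambda>\<omega>. g (picks \<omega>) :: real)"
  by (rule integrable_finite_range[OF picks_measurable finite_pick_vectors])

lemma residues_picks_measurable:
  assumes "i \<in> {1..k}" "j \<in> {1..k}" "0 < B * C"
  shows "(\<lambda>\<omega>. (picks \<omega>, residue i \<omega>, residue j \<omega>)) \<in>
    measurable M (count_space (pick_vectors \<times> {..<B*C} \<times> {..<B*C}))" (is "?Z \<in> _")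
proof -
  have "?Z -` {(w, a, b)} \<inter> space M \<in> events" if "w \<in> pick_vectors" for w a b
  proof -
    have "?Z -` {(w, a, b)} \<inter> space M = {\<omega> \<in> space M. picks \<omega> = w} \<inter>
        ({\<omega> \<in> space M. residue i \<omega> \<in> {a}} \<inter> {\<omega> \<in> space M. residue j \<omega> \<in> {b}})" by auto
    then show ?thesis
      using residue_event[OF assms(1), of "{a}"] residue_event[OF assms(2), of "{b}"] picks_event[OF that]
      by (simp only: sets.Int)
  qed
  moreover have "finite (pick_vectors \<times> {..<B*C} \<times> {..<B*C})"
    using finite_pick_vectors by simp
  ultimately show ?thesis
    using picks_range assms(3) by (auto simp: measurable_count_space_eq2 residue_def)
qed

text \<open>Distinct pointers have independent uniform residues, also independent of the picks, so
  each residue contributes a factor \<open>1 / (B * C)\<close>.\<close>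

lemma prob_picks_residues:
  assumes ij: "i \<in> {1..k}" "j \<in> {1..k}" "i \<noteq> j" and ab: "a < B * C" "b < B * C"
    and w: "w \<in> pick_vectors"
  shows "prob {\<omega> \<in> space M. (picks \<omega>, residue i \<omega>, residue j \<omega>) = (w, a, b)} =
    prob {\<omega> \<in> space M. picks \<omega> = w} / (real (B * C))\<^sup>2"
proof -
  let ?R = "\<lambda>l. if l = i then {a} else {b}"
  have "prob {\<omega> \<in> space M. (picks \<omega>, residue i \<omega>, residue j \<omega>) = (w, a, b)} =
      prob {\<omega> \<in> space M. (\<forall>l\<in>{i,j}. residue l \<omega> \<in> ?R l) \<and> (\<forall>t\<in>{..<n}. pick t \<omega> \<in> {w t})}"
    using ij picks_eq_iff[OF w] by (intro arg_cong[where f = prob]) auto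
  moreover have "\<dots> = (\<Prod>l\<in>{i,j}. prob {\<omega> \<in> space M. residue l \<omega> \<in> ?R l}) *
      (\<Prod>t\<in>{..<n}. prob {\<omega> \<in> space M. pick t \<omega> \<in> {w t}})"
    using ij by (intro prob_residues_picks) auto
  moreover have "(\<Prod>t\<in>{..<n}. prob {\<omega> \<in> space M. pick t \<omega> \<in> {w t}}) = prob {\<omega> \<in> space M. picks \<omega> = w}"
    using prob_picks[of "{..<n}" "\<lambda>t. {w t}"] picks_eq_iff[OF w] by simp
  moreover have "(\<Prod>l\<in>{i,j}. prob {\<omega> \<in> space M. residue l \<omega> \<in> ?R l}) = 1 / (real (B * C))\<^sup>2"
    using ij ab start_uniform by (simp add: residue_def power2_eq_square)
  ultimately show ?thesis by (simp only: mult_1_left times_divide_eq_left)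
qed

text \<open>Given the picks, the pair of residues is uniform on \<open>(B * C)^2\<close> values. So
  a count of residue pairs valid for every fixed pick vector becomes a bound on the
  expectation.\<close>

lemma
  fixes f :: "(nat \<Rightarrow> nat) \<Rightarrow> nat \<Rightarrow> nat \<Rightarrow> real"
  assumes ij: "i \<in> {1..k}" "j \<in> {1..k}" "i \<noteq> j" and BC: "0 < B * C"
  shows integrable_picks_residues: "integrable M (\<lambda>\<omega>. f (picks \<omega>) (residue i \<omega>) (residue j \<omega>))"
    and expectation_picks_residues_le:
      "(\<And>w. (\<Sum>a<B*C. \<Sum>b<B*C. f w a b) \<le> g w * (real (B * C))\<^sup>2) \<Longrightarrow>
       expectation (\<lambda>\<omega>. f (picks \<omega>) (residue i \<omega>) (residue j \<omega>)) \<le> expectation (\<lambda>\<omega>. g (picks \<omega>))"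
proof -
  let ?Z = "\<lambda>\<omega>. (picks \<omega>, residue i \<omega>, residue j \<omega>)"
  let ?h = "\<lambda>(w, a, b). f w a b"
  let ?F = "pick_vectors \<times> {..<B*C} \<times> {..<B*C}"
  have Z: "?Z \<in> measurable M (count_space ?F)" by (rule residues_picks_measurable) fact+
  have fin: "finite ?F" using finite_pick_vectors by simp
  show "integrable M (\<lambda>\<omega>. f (picks \<omega>) (residue i \<omega>) (residue j \<omega>))"
    using integrable_finite_range[OF Z fin, of ?h] by simp
  assume bound: "\<And>w. (\<Sum>a<B*C. \<Sum>b<B*C. f w a b) \<le> g w * (real (B * C))\<^sup>2"
  let ?P = "\<lambda>w. prob {\<omega> \<in> space M. picks \<omega> = w}"
  have "expectation (\<lambda>\<omega>. f (picks \<omega>) (residue i \<omega>) (residue j \<omega>)) =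
      (\<Sum>z\<in>?F. ?h z * prob {\<omega> \<in> space M. ?Z \<omega> = z})"
    using expectation_finite_range[OF Z fin, of ?h] by simp
  also have "\<dots> = (\<Sum>z\<in>?F. case z of (w, a, b) \<Rightarrow> f w a b * (?P w / (real (B * C))\<^sup>2))"
    using prob_picks_residues[OF ij] by (intro sum.cong refl) (auto simp del: prod.inject)
  also have "\<dots> = (\<Sum>w\<in>pick_vectors. \<Sum>a<B*C. \<Sum>b<B*C. f w a b * (?P w / (real (B * C))\<^sup>2))"
    by (simp add: sum.cartesian_product)
  also have "\<dots> = (\<Sum>w\<in>pick_vectors. (\<Sum>a<B*C. \<Sum>b<B*C. f w a b) * (?P w / (real (B * C))\<^sup>2))"
    by (simp only: sum_distrib_right)
  also have "\<dots> \<le> (\<Sum>w\<in>pick_vectors. g w * (real (B * C))\<^sup>2 * (?P w / (real (B * C))\<^sup>2))"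
    by (intro sum_mono mult_right_mono bound) auto
  also have "\<dots> = (\<Sum>w\<in>pick_vectors. g w * ?P w)"
    using BC by (intro sum.cong refl) auto
  also have "\<dots> = expectation (\<lambda>\<omega>. g (picks \<omega>))"
    using expectation_finite_range[OF picks_measurable finite_pick_vectors, of g] by simp
  finally show "expectation (\<lambda>\<omega>. f (picks \<omega>) (residue i \<omega>) (residue j \<omega>)) \<le> expectation (\<lambda>\<omega>. g (picks \<omega>))" .
qed

section \<open>Expected contribution of each cause of a miss\<close>

lemma prob_pick: "t < n \<Longrightarrow> i \<in> {1..k} \<Longrightarrow> prob {\<omega> \<in> space M. pick t \<omega> \<in> {i}} = p i"
  using pick_distribution by simp

lemma expectation_pick:
  assumes "t < n" "i \<in> {1..k}"
  shows "expectation (\<lambda>\<omega>. of_bool (picks \<omega> t = i)) = p i"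
proof -
  have "expectation (\<lambda>\<omega>. of_bool (picks \<omega> t = i) :: real) =
      expectation (indicator {\<omega> \<in> space M. pick t \<omega> \<in> {i}})"
    using assms(1) by (intro Bochner_Integration.integral_cong) (auto simp: picks_def indicator_def)
  then show ?thesis using pick_event[of t "{i}"] prob_pick assms by simp
qed

lemma prob_pick_other:
  assumes "t < n" "i \<in> {1..k}" "j \<in> {1..k}" "i \<noteq> j"
  shows "prob {\<omega> \<in> space M. pick t \<omega> \<in> - {i, j}} = 1 - p i - p j"
proof -
  let ?E = "\<lambda>i. {\<omega> \<in> space M. pick t \<omega> \<in> {i}}"
  have "{\<omega> \<in> space M. pick t \<omega> \<in> - {i, j}} = space M - (?E i \<union> ?E j)" by auto
  moreover have "prob (?E i \<union> ?E j) = prob (?E i) + prob (?E j)"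
    using assms(4) by (intro finite_measure_Union pick_event[OF assms(1)]) auto
  moreover have "?E i \<union> ?E j \<in> events"
    by (intro sets.Un pick_event[OF assms(1)])
  ultimately show ?thesis
    using prob_compl[of "?E i \<union> ?E j"] prob_pick[OF assms(1)] assms(2,3) by simp
qed

lemma expectation_recent_picks_nonempty:
  assumes t: "t < n" and ij: "i \<in> {1..k}" "j \<in> {1..k}" "i \<noteq> j"
  shows "expectation (\<lambda>\<omega>. of_bool (picks \<omega> t = i \<and> recent_picks (picks \<omega>) i j t \<noteq> {}))
    \<le> p i * p j / (p i + p j)"
proof -
  \<comment> \<open>The probability that a round picks neither \<open>i\<close> nor
    \<open>j\<close>, which becomes the ratio of the geometric series.\<close>
  define q where "q = 1 - p i - p j"
  have p0: "p i \<ge> 0" "p j \<ge> 0"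
    by (simp_all only: prob_pick[OF t ij(1), symmetric] prob_pick[OF t ij(2), symmetric] measure_nonneg)
  have q0: "q \<ge> 0" using prob_pick_other[OF t ij] by (metis measure_nonneg q_def)
  let ?A = "\<lambda>u v. if v = t then {i} else if v = u then {j} else - {i, j}"
  \<comment> \<open>\<open>E u\<close>: round \<open>u\<close> is the last one in which \<open>j\<close> was picked before \<open>i\<close> in round \<open>t\<close>.\<close>
  define E where "E = (\<lambda>u. {\<omega> \<in> space M. \<forall>v\<in>{u..t}. pick v \<omega> \<in> ?A u v})"
  have E: "E u \<in> events" for u
    unfolding E_def using t by (intro sets.sets_Collect_finite_All pick_event) auto
  have probE: "prob (E u) = p i * p j * q ^ (t - Suc u)" if u: "u < t" for u
  proof -
    have split: "{u..t} = insert t (insert u {u<..<t})" using u by auto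
    have "prob (E u) = (\<Prod>v\<in>{u..t}. prob {\<omega> \<in> space M. pick v \<omega> \<in> ?A u v})"
      unfolding E_def using t by (intro prob_picks) auto
    also have "\<dots> = p i * (p j * (\<Prod>v\<in>{u<..<t}. prob {\<omega> \<in> space M. pick v \<omega> \<in> ?A u v}))"
      using u t ij prob_pick[of t i] prob_pick[of u j] unfolding split by simp
    also have "(\<Prod>v\<in>{u<..<t}. prob {\<omega> \<in> space M. pick v \<omega> \<in> ?A u v}) = (\<Prod>v\<in>{u<..<t}. q)"
      using prob_pick_other[OF _ ij] t by (intro prod.cong refl) (simp add: q_def)
    finally show ?thesis by (simp add: mult.assoc)
  qed
  have "expectation (\<lambda>\<omega>. of_bool (picks \<omega> t = i \<and> recent_picks (picks \<omega>) i j t \<noteq> {}) :: real) \<le>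
      expectation (\<lambda>\<omega>. \<Sum>u<t. indicator (E u) \<omega>)"
  proof (rule integral_mono')
    show "integrable M (\<lambda>\<omega>. \<Sum>u<t. indicator (E u) \<omega> :: real)"
      using E by (intro Bochner_Integration.integrable_sum integrable_real_indicator) (auto simp: emeasure_eq_measure)
    fix \<omega> assume \<omega>: "\<omega> \<in> space M"
    show "0 \<le> (\<Sum>u<t. indicator (E u) \<omega> :: real)" by (intro sum_nonneg) auto
    show "of_bool (picks \<omega> t = i \<and> recent_picks (picks \<omega>) i j t \<noteq> {}) \<le> (\<Sum>u<t. indicator (E u) \<omega> :: real)"
    proof (cases "picks \<omega> t = i \<and> recent_picks (picks \<omega>) i j t \<noteq> {}")
      case True
      let ?S = "recent_picks (picks \<omega>) i j t"
      \<comment> \<open>The latest recent pick of \<open>j\<close> is the round whose event occurs: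
        before \<open>t\<close>, maximality excludes later picks of \<open>j\<close>, and recentness
        excludes later picks of \<open>i\<close>.\<close>
      define u where "u = Max ?S"
      have u: "u \<in> ?S" unfolding u_def using True by (intro Max_in) auto
      have "picks \<omega> v \<notin> {i, j}" if v: "u < v" "v < t" for v
      proof -
        have "v \<notin> ?S" using Max_ge[of ?S v] v unfolding u_def[symmetric] by auto
        moreover have "picks \<omega> x \<noteq> i" if "v \<le> x" "x < t" for x
          using u v that by (auto simp: recent_picks_def)
        ultimately show ?thesis using v by (auto simp: recent_picks_def)
      qed
      then have "\<omega> \<in> E u"
        using u True t \<omega> by (auto simp: E_def recent_picks_def picks_def)
      then have "1 = (indicator (E u) \<omega> :: real)" by simp
      also have "\<dots> \<le> (\<Sum>u<t. indicator (E u) \<omega>)"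
        using u by (intro member_le_sum) (auto simp: recent_picks_def)
      finally show ?thesis by simp
    qed (auto intro!: sum_nonneg)
  qed
  also have "\<dots> = (\<Sum>u<t. p i * p j * q ^ (t - Suc u))"
  proof -
    have "expectation (\<lambda>\<omega>. \<Sum>u<t. indicator (E u) \<omega> :: real) = (\<Sum>u<t. expectation (indicator (E u)))"
      using E by (intro Bochner_Integration.integral_sum integrable_real_indicator) (auto simp: emeasure_eq_measure)
    then show ?thesis using E probE by simp
  qed
  also have "\<dots> = p i * p j * (\<Sum>m<t. q ^ m)"
    by (simp add: sum.nat_diff_reindex[of "\<lambda>m. q ^ m"] flip: sum_distrib_left)
  also have "\<dots> \<le> p i * p j / (p i + p j)"
  proof (cases "p i + p j = 0")
    \<comment> \<open>Both probabilities vanish, and the right-hand side is \<open>0\<close> because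
      division by zero yields \<open>0\<close>.\<close>
    case True
    then show ?thesis using p0 by (simp add: add_nonneg_eq_0_iff)
  next
    case False
    then have pos: "p i + p j > 0" using p0 by linarith
    \<comment> \<open>Here \<open>1 - q = p i + p j\<close>, so this is the closed form of the
      finite geometric sum.\<close>
    have "(p i + p j) * (\<Sum>m<t. q ^ m) = 1 - q ^ t"
      using one_diff_power_eq[of q t] unfolding q_def by (simp only: diff_diff_eq diff_diff_eq2 add_diff_cancel_left')
    also have "\<dots> \<le> 1" using q0 by simp
    finally have "(\<Sum>m<t. q ^ m) \<le> 1 / (p i + p j)" using pos by (simp only: pos_le_divide_eq mult.commute)
    then have "p i * p j * (\<Sum>m<t. q ^ m) \<le> p i * p j * (1 / (p i + p j))"
      using p0 by (intro mult_left_mono) auto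
    then show ?thesis by simp
  qed
  finally show ?thesis .
qed

lemma expectation_new_block:
  assumes B: "B \<ge> 1" and C: "C \<ge> 1" and k: "2 \<le> k" and t: "t < n" and i: "i \<in> {1..k}"
  shows "integrable M (\<lambda>\<omega>. of_bool (picks \<omega> t = i \<and> (residue i \<omega> + pick_count (picks \<omega>) i t) mod B = 0) :: real)"
      (is "integrable M ?f")
    and "expectation (\<lambda>\<omega>. of_bool (picks \<omega> t = i \<and> (residue i \<omega> + pick_count (picks \<omega>) i t) mod B = 0))
      \<le> p i / real B"
proof -
  \<comment> \<open>\<open>expectation_picks_residues_le\<close> speaks of two pointers, so a second
    one is taken from \<open>2 \<le> k\<close>; its residue only contributes a factor
    \<open>B * C\<close> to the count.\<close>
  obtain j where j: "j \<in> {1..k}" "i \<noteq> j"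
    using k i by (metis atLeastAtMost_iff one_le_numeral le_trans numeral_One numeral_eq_iff semiring_norm(85) order_refl)
  have BC: "0 < B * C" using B C by simp
  let ?h = "\<lambda>w a b::nat. of_bool (w t = i \<and> (a + pick_count w i t) mod B = 0) :: real"
  show "integrable M ?f" using integrable_picks_residues[OF i j BC, of ?h] by simp
  have "expectation ?f \<le> expectation (\<lambda>\<omega>. of_bool (picks \<omega> t = i) / real B)"
  proof (rule expectation_picks_residues_le[OF i j BC, of ?h])
    fix w
    have "{..<B*C} \<inter> {a. (a + pick_count w i t) mod B = 0} = {a. a < B * C \<and> (a + pick_count w i t) mod B = 0}"
      by auto
    then have "(\<Sum>a<B*C. of_bool ((a + pick_count w i t) mod B = 0)) = real C"
      using card_shifted_multiples[OF B, of C "pick_count w i t"] by (simp add: of_bool_def sum.If_cases)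
    then have "(\<Sum>a<B*C. \<Sum>b<B*C. ?h w a b) = of_bool (w t = i) * (real (B * C) * real C)"
      by (cases "w t = i") (simp_all flip: sum_distrib_left)
    also have "\<dots> = of_bool (w t = i) / real B * (real (B * C))\<^sup>2"
      using B by (simp add: power2_eq_square)
    finally show "(\<Sum>a<B*C. \<Sum>b<B*C. ?h w a b) \<le> of_bool (w t = i) / real B * (real (B * C))\<^sup>2" by simp
  qed
  also have "\<dots> = p i / real B" using expectation_pick[OF t i] by simp
  finally show "expectation ?f \<le> p i / real B" .
qed

lemma expectation_collision:
  assumes B: "B \<ge> 1" and C: "C \<ge> 1" and ij: "i \<in> {1..k}" "j \<in> {1..k}" "i \<noteq> j"
  shows "(\<Sum>t<n. expectation (\<lambda>\<omega>. of_bool (collision B C (picks \<omega>) t i j (residue i \<omega>) (residue j \<omega>)))) \<le>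
    real n * ((real B - 1) / ((real B)\<^sup>2 * real C) * ((real B - 1) * (p i * p j / (p i + p j)) + p j))"
proof -
  have BC: "0 < B * C" using B C by simp
  \<comment> \<open>This is the factor \<open>C * (B - 1)\<close> from \<open>card_collision\<close>
    divided by the number \<open>(B * C)^2\<close> of residue pairs.\<close>
  define D where "D = (real B - 1) / ((real B)\<^sup>2 * real C)"
  have D: "D \<ge> 0" using B by (simp add: D_def)
  let ?N = "\<lambda>t w. of_bool (w t = i \<and> recent_picks w i j t \<noteq> {}) :: real"
  let ?K = "\<lambda>t w. of_bool (w t = i) * real (card (recent_picks w i j t))"
  have "(\<Sum>t<n. expectation (\<lambda>\<omega>. of_bool (collision B C (picks \<omega>) t i j (residue i \<omega>) (residue j \<omega>)))) \<le>
      (\<Sum>t<n. expectation (\<lambda>\<omega>. D * ((real B - 1) * ?N t (picks \<omega>) + ?K t (picks \<omega>))))"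
  proof (intro sum_mono expectation_picks_residues_le[OF ij BC, of "\<lambda>w a b. of_bool (collision B C w _ i j a b)"])
    fix t w
    have "D * (real (B * C))\<^sup>2 = real C * (real B - 1)"
      using B C by (simp add: D_def power2_eq_square)
    then have "D * ((real B - 1) * ?N t w + ?K t w) * (real (B * C))\<^sup>2 =
        of_bool (w t = i) * (real C * (real B - 1) *
        ((real B - 1) * of_bool (recent_picks w i j t \<noteq> {}) + real (card (recent_picks w i j t))))"
      by (cases "w t = i") (simp_all add: mult.assoc mult.left_commute[of D] mult.commute)
    then show "(\<Sum>a<B*C. \<Sum>b<B*C. of_bool (collision B C w t i j a b)) \<le>
        D * ((real B - 1) * ?N t w + ?K t w) * (real (B * C))\<^sup>2"
      using card_collision[OF B C, of w t i j] by simp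
  qed
  also have "\<dots> = D * ((real B - 1) * (\<Sum>t<n. expectation (\<lambda>\<omega>. ?N t (picks \<omega>))) +
      (\<Sum>t<n. expectation (\<lambda>\<omega>. ?K t (picks \<omega>))))"
    using integrable_picks[of "?N _"] integrable_picks[of "?K _"]
    by (simp add: sum.distrib flip: sum_distrib_left)
  also have "\<dots> \<le> D * ((real B - 1) * (real n * (p i * p j / (p i + p j))) + real n * p j)"
  proof (intro mult_left_mono add_mono D)
    show "(\<Sum>t<n. expectation (\<lambda>\<omega>. ?N t (picks \<omega>))) \<le> real n * (p i * p j / (p i + p j))"
      using sum_bounded_above[of "{..<n}" "\<lambda>t. expectation (\<lambda>\<omega>. ?N t (picks \<omega>))" "p i * p j / (p i + p j)"]
        expectation_recent_picks_nonempty[OF _ ij] by simp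
    \<comment> \<open>The cardinalities are bounded only after summation over the rounds, so the sum
      is first moved inside the expectation.\<close>
    have "(\<Sum>t<n. expectation (\<lambda>\<omega>. ?K t (picks \<omega>))) = expectation (\<lambda>\<omega>. \<Sum>t<n. ?K t (picks \<omega>))"
      using integrable_picks[of "?K _"] by (subst Bochner_Integration.integral_sum) auto
    also have "\<dots> \<le> expectation (\<lambda>\<omega>. \<Sum>u<n. of_bool (picks \<omega> u = j))"
      by (intro integral_mono sum_card_recent_picks integrable_picks[of "\<lambda>w. \<Sum>t<n. ?K t w"]
          integrable_picks[of "\<lambda>w. \<Sum>u<n. of_bool (w u = j)"])
    also have "\<dots> = (\<Sum>u<n. expectation (\<lambda>\<omega>. of_bool (picks \<omega> u = j)))"
      by (intro Bochner_Integration.integral_sum integrable_picks[of "\<lambda>w. of_bool (w _ = j)"])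
    also have "\<dots> = real n * p j" using expectation_pick ij by simp
    finally show "(\<Sum>t<n. expectation (\<lambda>\<omega>. ?K t (picks \<omega>))) \<le> real n * p j" .
  qed (use B in auto)
  also have "\<dots> = real n * (D * ((real B - 1) * (p i * p j / (p i + p j)) + p j))"
    by (simp add: algebra_simps)
  finally show ?thesis by (simp only: D_def)
qed

section \<open>Assembling the bound\<close>

lemma expectation_cache_misses:
  assumes B: "B \<ge> 1" and C: "C \<ge> 1" and k: "2 \<le> k" and p0: "\<And>i. i \<in> {1..k} \<Longrightarrow> p i \<ge> 0"
    and p1: "(\<Sum>i=1..k. p i) = 1"
  shows "expectation (\<lambda>\<omega>. real (cache_misses B C empty_cache (accesses (\<lambda>i. start i \<omega>) (\<lambda>t. pick t \<omega>) n)))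
    \<le> real k + real n * (1 / real B + real k * (real B - 1) / ((real B)\<^sup>2 * real C)
         + (real B - 1)\<^sup>2 / ((real B)\<^sup>2 * real C) * (\<Sum>i=1..k. \<Sum>j=1..k. p i * p j / (p i + p j)))"
proof -
  define D where "D = (real B - 1) / ((real B)\<^sup>2 * real C)"
  have D: "D \<ge> 0" using B by (simp add: D_def)
  have BC: "0 < B * C" using B C by simp
  let ?new = "\<lambda>t i \<omega>. of_bool (picks \<omega> t = i \<and> (residue i \<omega> + pick_count (picks \<omega>) i t) mod B = 0) :: real"
  let ?col = "\<lambda>t i j \<omega>. of_bool (collision B C (picks \<omega>) t i j (residue i \<omega>) (residue j \<omega>)) :: real"
  let ?U = "\<lambda>\<omega>. real k + (\<Sum>t<n. \<Sum>i=1..k. ?new t i \<omega>) + (\<Sum>t<n. \<Sum>i=1..k. \<Sum>j\<in>{1..k} - {i}. ?col t i j \<omega>)"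
  have int_new: "integrable M (?new t i)" if "t < n" "i \<in> {1..k}" for t i
    by (rule expectation_new_block(1)[OF B C k that])
  have int_col: "integrable M (?col t i j)" if "i \<in> {1..k}" "j \<in> {1..k}" "i \<noteq> j" for t i j
    by (rule integrable_picks_residues[OF that BC, of "\<lambda>w a b. of_bool (collision B C w t i j a b)"])
  have int: "integrable M (\<lambda>\<omega>. \<Sum>t<n. \<Sum>i=1..k. ?new t i \<omega>)"
      "integrable M (\<lambda>\<omega>. \<Sum>t<n. \<Sum>i=1..k. \<Sum>j\<in>{1..k} - {i}. ?col t i j \<omega>)"
    by (intro Bochner_Integration.integrable_sum int_new int_col; auto)+
  have "expectation (\<lambda>\<omega>. real (cache_misses B C empty_cache (accesses (\<lambda>i. start i \<omega>) (\<lambda>t. pick t \<omega>) n)))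
      \<le> expectation ?U"
  \<comment> \<open>This rule asks for integrability of the upper bound only, so measurability of
    the miss count does not have to be established.\<close>
  proof (rule integral_mono')
    show "integrable M ?U" using int by simp
    fix \<omega> assume \<omega>: "\<omega> \<in> space M"
    show "0 \<le> ?U \<omega>" by (intro add_nonneg_nonneg sum_nonneg) auto
    have "accesses (\<lambda>i. start i \<omega>) (\<lambda>t. pick t \<omega>) n = accesses (\<lambda>i. start i \<omega>) (picks \<omega>) n"
      by (rule accesses_cong) (simp add: picks_def)
    moreover have "picks \<omega> t \<in> {1..k}" if "t < n" for t
      using pick_range[OF that \<omega>] that by (simp add: picks_def)
    ultimately show "real (cache_misses B C empty_cache (accesses (\<lambda>i. start i \<omega>) (\<lambda>t. pick t \<omega>) n)) \<le> ?U \<omega>"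
      using cache_misses_bound[of n "picks \<omega>" k B C "\<lambda>i. start i \<omega>"] by (simp add: residue_def)
  qed
  also have "\<dots> = real k + expectation (\<lambda>\<omega>. \<Sum>t<n. \<Sum>i=1..k. ?new t i \<omega>) +
      expectation (\<lambda>\<omega>. \<Sum>t<n. \<Sum>i=1..k. \<Sum>j\<in>{1..k} - {i}. ?col t i j \<omega>)"
    using int by (simp add: prob_space)
  also have "expectation (\<lambda>\<omega>. \<Sum>t<n. \<Sum>i=1..k. ?new t i \<omega>) = (\<Sum>t<n. \<Sum>i=1..k. expectation (?new t i))"
    by (subst Bochner_Integration.integral_sum, intro Bochner_Integration.integrable_sum int_new)
      (auto intro!: sum.cong Bochner_Integration.integral_sum int_new simp del: sum_of_bool_eq)
  also have "\<dots> \<le> (\<Sum>t<n. \<Sum>i=1..k. p i / real B)"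
    by (intro sum_mono expectation_new_block(2)[OF B C k]) auto
  also have "\<dots> = real n * (1 / real B)"
    using p1 by (simp flip: sum_divide_distrib)
  also have "expectation (\<lambda>\<omega>. \<Sum>t<n. \<Sum>i=1..k. \<Sum>j\<in>{1..k} - {i}. ?col t i j \<omega>) =
      (\<Sum>t<n. \<Sum>i=1..k. \<Sum>j\<in>{1..k} - {i}. expectation (?col t i j))"
  proof -
    have int_j: "integrable M (\<lambda>\<omega>. \<Sum>j\<in>{1..k} - {i}. ?col t i j \<omega>)" if "i \<in> {1..k}" for t i
      using that by (intro Bochner_Integration.integrable_sum int_col) auto
    have int_i: "integrable M (\<lambda>\<omega>. \<Sum>i=1..k. \<Sum>j\<in>{1..k} - {i}. ?col t i j \<omega>)" for t
      by (intro Bochner_Integration.integrable_sum int_j)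
    have "expectation (\<lambda>\<omega>. \<Sum>t<n. \<Sum>i=1..k. \<Sum>j\<in>{1..k} - {i}. ?col t i j \<omega>) =
        (\<Sum>t<n. expectation (\<lambda>\<omega>. \<Sum>i=1..k. \<Sum>j\<in>{1..k} - {i}. ?col t i j \<omega>))"
      by (rule Bochner_Integration.integral_sum) (rule int_i)
    also have "\<dots> = (\<Sum>t<n. \<Sum>i=1..k. expectation (\<lambda>\<omega>. \<Sum>j\<in>{1..k} - {i}. ?col t i j \<omega>))"
      by (intro sum.cong refl Bochner_Integration.integral_sum int_j)
    also have "\<dots> = (\<Sum>t<n. \<Sum>i=1..k. \<Sum>j\<in>{1..k} - {i}. expectation (?col t i j))"
      by (intro sum.cong refl Bochner_Integration.integral_sum int_col) auto
    finally show ?thesis .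
  qed
  \<comment> \<open>\<open>expectation_collision\<close> bounds the sum over all rounds for a fixed
    pair, so that sum is moved innermost.\<close>
  also have "\<dots> = (\<Sum>i=1..k. \<Sum>j\<in>{1..k} - {i}. \<Sum>t<n. expectation (?col t i j))"
  proof -
    have "(\<Sum>t<n. \<Sum>i=1..k. \<Sum>j\<in>{1..k} - {i}. expectation (?col t i j)) =
        (\<Sum>i=1..k. \<Sum>t<n. \<Sum>j\<in>{1..k} - {i}. expectation (?col t i j))"
      by (rule sum.swap)
    also have "\<dots> = (\<Sum>i=1..k. \<Sum>j\<in>{1..k} - {i}. \<Sum>t<n. expectation (?col t i j))"
      by (rule sum.cong[OF refl]) (rule sum.swap)
    finally show ?thesis .
  qed
  also have "\<dots> \<le> (\<Sum>i=1..k. \<Sum>j\<in>{1..k} - {i}. real n * (D * ((real B - 1) * (p i * p j / (p i + p j)) + p j)))"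
    unfolding D_def by (intro sum_mono expectation_collision[OF B C]) auto
  \<comment> \<open>Adding the nonnegative terms with \<open>j = i\<close> completes the double sum.
    The \<open>p j\<close> then add up to 1 for each \<open>i\<close>, which yields the summand
    \<open>real k\<close>.\<close>
  also have "\<dots> \<le> (\<Sum>i=1..k. \<Sum>j=1..k. real n * (D * ((real B - 1) * (p i * p j / (p i + p j)) + p j)))"
    using D p0 B by (intro sum_mono sum_mono2) (auto intro!: mult_nonneg_nonneg add_nonneg_nonneg divide_nonneg_nonneg)
  also have "\<dots> = real n * (D * ((real B - 1) * (\<Sum>i=1..k. \<Sum>j=1..k. p i * p j / (p i + p j)) + real k))"
    by (simp only: sum.distrib sum_distrib_left[symmetric] p1) simp
  also have "D * ((real B - 1) * S + real k) =
      real k * (real B - 1) / ((real B)\<^sup>2 * real C) + (real B - 1)\<^sup>2 / ((real B)\<^sup>2 * real C) * S" for S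
    by (simp add: D_def power2_eq_square[of "real B - 1"] add_divide_distrib distrib_left mult.commute)
  finally show ?thesis by (simp only: distrib_left add.assoc)
qed

end

theorem theorem6:
  fixes M :: "'a measure"
    and B C k n :: nat
    and p :: "nat \<Rightarrow> real"
    and start pick :: "nat \<Rightarrow> 'a \<Rightarrow> nat"
  assumes "B \<ge> 1" and "C \<ge> 1"
    and "2 \<le> k" and "k \<le> C * B" and "B dvd k"
    and "\<And>i. i \<in> {1..k} \<Longrightarrow> p i \<ge> 0" and "(\<Sum>i=1..k. p i) = 1"
    and "sequence_access M B C k n p start pick"
  shows "(\<integral>\<omega>. real (cache_misses B C empty_cache
              (accesses (\<lambda>i. start i \<omega>) (\<lambda>t. pick t \<omega>) n)) \<partial>M)
    \<le> real k + real n *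
        (1 / real B
         + real k * (real B - 1) / ((real B)\<^sup>2 * real C)
         + (real B - 1)\<^sup>2 / ((real B)\<^sup>2 * real C)
             * (\<Sum>i=1..k. \<Sum>j=1..k. p i * p j / (p i + p j)))"
  using assms sequence_access.expectation_cache_misses[of M B C k n p start pick] by blast

end
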